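(* Let $r\geq 2$ and $t\geq 2$ be integers, and let $K\geq R(K_r,K_t)$. If $G$ is a $K_{r+1}$-free graph of order $n$ with \[ \lambda(G)\geq K n^{1/2}, \] then $G$ contains an induced copy of $K_{2,t}$.
   Context: All graphs are finite and simple. $\lambda(G)$ denotes the largest eigenvalue of the adjacency matrix of $G$. A graph is $K_{r+1}$-free if it contains no complete subgraph on $r+1$ vertices. $R(K_r,K_t)$ is the classical Ramsey number: the least $N$ such that every graph on $N$ vertices contains a clique of size $r$ or an independent set of size $t$. An induced copy of $K_{2,t}$ is an induced subgraph isomorphic to the complete bipartite graph $K_{2,t}$. *)

theory Defs
  imports
    Complex_Main
    "HOL-Library.Countable_Set"
    "Graph_Theory.Graph_Theory"
    "Jordan_Normal_Form.Spectral_Radius"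
begin

text \<open>
  Finite simple graphs are the loop-free symmetric digraphs without parallel arcs of the locale
  \<^locale>\<open>graph\<close>: every undirected edge is represented by its two opposite arcs, so
  \<^const>\<open>arcs_ends\<close> is the adjacency relation.
\<close>

definition has_clique :: "('a, 'b) pre_digraph \<Rightarrow> nat \<Rightarrow> bool" where
  "has_clique G r \<longleftrightarrow> (\<exists>H. subgraph H G \<and> complete_digraph r H)"

definition clique_free :: "('a, 'b) pre_digraph \<Rightarrow> nat \<Rightarrow> bool" where
  "clique_free G r \<longleftrightarrow> \<not> has_clique G r"

definition has_independent_set :: "('a, 'b) pre_digraph \<Rightarrow> nat \<Rightarrow> bool" where
  "has_independent_set G t \<longleftrightarrow>
    (\<exists>S \<subseteq> verts G. card S = t \<and> (\<forall>u\<in>S. \<forall>v\<in>S. (u, v) \<notin> arcs_ends G))"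

definition has_induced_complete_bipartite :: "('a, 'b) pre_digraph \<Rightarrow> nat \<Rightarrow> nat \<Rightarrow> bool" where
  "has_induced_complete_bipartite G s t \<longleftrightarrow>
    (\<exists>H. induced_subgraph H G \<and> complete_bipartite_digraph s t H)"

text \<open>
  Up to isomorphism every finite simple graph has natural numbers as vertices and pairs of them as
  arcs, so quantifying over these types loses nothing. By Ramsey's theorem the least number exists.
\<close>

definition ramsey_number :: "nat \<Rightarrow> nat \<Rightarrow> nat" where
  "ramsey_number r t =
    (LEAST N. \<forall>G :: (nat, nat \<times> nat) pre_digraph.
       graph G \<and> card (verts G) = N \<longrightarrow> has_clique G r \<or> has_independent_set G t)"

text \<open>
  For a finite set \<open>V\<close>, \<^term>\<open>from_nat_into V\<close> is a bijection from \<open>{..<card V}\<close> onto \<open>V\<close>.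
  Another enumeration of the vertices gives a similar matrix, hence the same eigenvalues.
\<close>

definition adjacency_matrix :: "('a, 'b) pre_digraph \<Rightarrow> real mat" where
  "adjacency_matrix G =
    mat (card (verts G)) (card (verts G))
      (\<lambda>(i, j). if (from_nat_into (verts G) i, from_nat_into (verts G) j) \<in> arcs_ends G
                then 1 else 0)"

text \<open>
  The matrix is real symmetric, so all its eigenvalues are real; for a graph with at least one
  vertex the spectrum is finite and nonempty. For the null graph the value is unspecified.
\<close>

definition largest_eigenvalue :: "('a, 'b) pre_digraph \<Rightarrow> real" where
  "largest_eigenvalue G = Max (spectrum (adjacency_matrix G))"

end

theory Submission
  imports Defs "HOL-Library.Ramsey" "HOL-Analysis.Convex"
begin

text \<open>
  Without an induced \<open>K\<^bsub>2,t\<^esub>\<close>, two nonadjacent vertices have fewer than \<open>R = R(K\<^sub>r, K\<^sub>t)\<close> common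
  neighbours. Let \<open>y\<close> be the entrywise absolute value of an eigenvector for the largest eigenvalue
  \<open>\<lambda>\<close>. The neighbourhood of a vertex \<open>w\<close> is \<open>K\<^sub>r\<close>-free, so Motzkin-Straus bounds
  \<open>(\<lambda> y\<^sub>w)\<^sup>2\<close> by \<open>r - 1\<close> times the sum of \<open>y\<^sub>u y\<^sub>v\<close> over the ordered pairs of equal or nonadjacent
  neighbours \<open>u\<close>, \<open>v\<close> of \<open>w\<close>. Summing over \<open>w\<close> turns each pair into its number of common neighbours,
  at most \<open>R - 1\<close> off the diagonal and at most \<open>n\<close> on it, whence
  \<open>\<lambda>\<^sup>2 \<le> (r - 1) R n < R\<^sup>2 n\<close>, since \<open>r \<le> R\<close>.
\<close>

section \<open>Cliques and induced bipartite subgraphs in terms of vertex sets\<close>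

lemma arcs_ends_induce:
  "arcs_ends (G \<restriction> S) = arcs_ends G \<inter> S \<times> S"
  by (auto simp: arcs_ends_conv)

lemma (in graph) graph_induce:
  assumes "S \<subseteq> verts G"
  shows "graph (G \<restriction> S)"
proof -
  have ind: "induced_subgraph (G \<restriction> S) G"
    using assms by (rule induced_induce)
  show ?thesis
    by (rule digraph.graphI[OF digraphI_induced[OF ind] induced_graph_imp_symmetric[OF sym_arcs ind]])
qed

text \<open>Arcs of a subgraph are arcs of \<open>G\<close>; conversely, the subgraph induced on a
  set of pairwise adjacent vertices is complete. Cliques can then be enlarged by inserting a vertex
  into a set.\<close>

lemma (in graph) has_clique_iff:
  "has_clique G r \<longleftrightarrow> (\<exists>S\<subseteq>verts G. card S = r \<and> pairwise (\<lambda>u v. (u, v) \<in> arcs_ends G) S)"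
proof
  assume "has_clique G r"
  then obtain H where H: "subgraph H G" "complete_digraph r H"
    by (auto simp: has_clique_def)
  then have "arcs_ends H \<subseteq> arcs_ends G"
    by (auto simp: subgraph_def compatible_def arcs_ends_conv)
  then show "\<exists>S\<subseteq>verts G. card S = r \<and> pairwise (\<lambda>u v. (u, v) \<in> arcs_ends G) S"
    using H by (intro exI[of _ "verts H"]) (auto simp: complete_digraph_def subgraph_def pairwise_def)
next
  assume "\<exists>S\<subseteq>verts G. card S = r \<and> pairwise (\<lambda>u v. (u, v) \<in> arcs_ends G) S"
  then obtain S where S: "S \<subseteq> verts G" "card S = r" "pairwise (\<lambda>u v. (u, v) \<in> arcs_ends G) S"
    by blast
  have "complete_digraph r (G \<restriction> S)"
    using S graph_induce[OF S(1)]
    by (auto simp: complete_digraph_def arcs_ends_induce pairwise_def dest: adj_not_same)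
  then show "has_clique G r"
    using induced_induce[OF S(1)] by (auto simp: has_clique_def)
qed

lemma (in graph) has_induced_complete_bipartiteI:
  assumes "U \<subseteq> verts G" "W \<subseteq> verts G" "U \<inter> W = {}" "card U = s" "card W = t"
    and "\<And>u v. u \<in> U \<Longrightarrow> v \<in> U \<Longrightarrow> (u, v) \<notin> arcs_ends G"
    and "\<And>u v. u \<in> W \<Longrightarrow> v \<in> W \<Longrightarrow> (u, v) \<notin> arcs_ends G"
    and "\<And>u w. u \<in> U \<Longrightarrow> w \<in> W \<Longrightarrow> (u, w) \<in> arcs_ends G"
  shows "has_induced_complete_bipartite G s t"
proof -
  have UW: "U \<union> W \<subseteq> verts G"
    using assms by blast
  have "arcs_ends (G \<restriction> (U \<union> W)) = U \<times> W \<union> W \<times> U"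
    using assms arcs_ends_symmetric[OF sym_arcs] by (auto simp: arcs_ends_induce)
  then have "complete_bipartite_digraph s t (G \<restriction> (U \<union> W))"
    using graph_induce[OF UW] assms by (auto simp: complete_bipartite_digraph_def)
  then show ?thesis
    using induced_induce[OF UW] by (auto simp: has_induced_complete_bipartite_def)
qed

section \<open>Ramsey numbers on arbitrary vertex types\<close>

lemma graph_with_projI:
  assumes "finite V" "E \<subseteq> V \<times> V" "sym E" "irrefl E"
  shows "graph (with_proj \<lparr>pverts = V, parcs = E\<rparr>)"
proof -
  have "finite E"
    using assms finite_subset by blast
  then show ?thesis
    using assms
    by unfold_locales
       (auto simp: symmetric_def arc_to_ends_def irrefl_def)
qed

text \<open>Ramsey's theorem \<open>ramsey2\<close> provides some order with the required property,
  so the \<open>LEAST\<close> in the definition is attained.\<close>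

lemma ramsey_number_spec:
  fixes G :: "(nat, nat \<times> nat) pre_digraph"
  assumes "graph G" "card (verts G) = ramsey_number r t"
  shows "has_clique G r \<or> has_independent_set G t"
proof -
  obtain N where N: "\<And>(V::nat set) (F::nat set set). finite V \<Longrightarrow> card V \<ge> N \<Longrightarrow>
      \<exists>S\<subseteq>V. card S = r \<and> clique S F \<or> card S = t \<and> indep S F"
    using ramsey2[of r t] by metis
  have "has_clique H r \<or> has_independent_set H t"
    if "graph H" "card (verts H) = N" for H :: "(nat, nat \<times> nat) pre_digraph"
  proof -
    interpret H: graph H by fact
    let ?F = "{{u, v} |u v. (u, v) \<in> arcs_ends H}"
    \<comment> \<open>\<open>ramsey2\<close> speaks of unordered edges; by symmetry of the arcs,
      passing to two-element sets loses no information.\<close>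
    have F: "{u, v} \<in> ?F \<longleftrightarrow> (u, v) \<in> arcs_ends H" for u v
      using arcs_ends_symmetric[OF H.sym_arcs] by (auto simp: doubleton_eq_iff)
    obtain S where S: "S \<subseteq> verts H" "card S = r \<and> clique S ?F \<or> card S = t \<and> indep S ?F"
      using N[of "verts H" ?F] \<open>card (verts H) = N\<close> H.finite_verts by (metis (lifting) order_refl)
    from S(2) show ?thesis
    proof
      assume "card S = r \<and> clique S ?F"
      then have "has_clique H r"
        using S(1) unfolding H.has_clique_iff clique_def pairwise_def F by blast
      then show ?thesis ..
    next
      assume "card S = t \<and> indep S ?F"
      then have "has_independent_set H t"
        using S(1) H.adj_not_same unfolding has_independent_set_def indep_def F by metis
      then show ?thesis ..
    qed
  qed
  then have "\<exists>N. \<forall>G :: (nat, nat \<times> nat) pre_digraph.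
      graph G \<and> card (verts G) = N \<longrightarrow> has_clique G r \<or> has_independent_set G t"
    by blast
  from LeastI_ex[OF this] show ?thesis
    using assms unfolding ramsey_number_def by blast
qed

text \<open>Frees the Ramsey property from the vertex type \<open>nat\<close> and from the exact
  order: a subset of exactly \<open>ramsey_number r t\<close> elements is numbered, and the set
  found among the indices is mapped back injectively.\<close>

lemma ramsey_number_relation:
  assumes "finite W" "card W \<ge> ramsey_number r t" "sym E" "irrefl E"
  obtains S where "S \<subseteq> W" "card S = r" "pairwise (\<lambda>u v. (u, v) \<in> E) S"
    | S where "S \<subseteq> W" "card S = t" "\<And>u v. u \<in> S \<Longrightarrow> v \<in> S \<Longrightarrow> (u, v) \<notin> E"
proof -
  let ?N = "ramsey_number r t"
  obtain W' where W': "W' \<subseteq> W" "card W' = ?N" "finite W'"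
    using assms obtain_subset_with_card_n by metis
  then obtain f where f: "bij_betw f {..<?N} W'"
    using ex_bij_betw_nat_finite[of W'] by (auto simp: lessThan_atLeast0)
  let ?E = "{(i, j). i < ?N \<and> j < ?N \<and> (f i, f j) \<in> E}"
  define H where "H = with_proj \<lparr>pverts = {..<?N}, parcs = ?E\<rparr>"
  interpret H: graph H
    unfolding H_def using assms by (intro graph_with_projI) (auto simp: sym_def irrefl_def)
  have H: "verts H = {..<?N}" "arcs_ends H = ?E"
    by (simp_all add: H_def)
  have sub: "f ` S \<subseteq> W \<and> card (f ` S) = card S" if "S \<subseteq> {..<?N}" for S
    using that f W'(1) by (auto simp: bij_betw_def intro!: card_image intro: inj_on_subset)
  have "has_clique H r \<or> has_independent_set H t"
    by (rule ramsey_number_spec) (simp_all add: H H.graph_axioms)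
  then show thesis
  proof
    assume "has_clique H r"
    then obtain S where S: "S \<subseteq> {..<?N}" "card S = r" "pairwise (\<lambda>u v. (u, v) \<in> ?E) S"
      unfolding H.has_clique_iff H by blast
    have "pairwise (\<lambda>u v. (u, v) \<in> E) (f ` S)"
      using S(3) by (fastforce simp: pairwise_def)
    then show thesis
      using that(1)[of "f ` S"] sub S by blast
  next
    assume "has_independent_set H t"
    then obtain S where S: "S \<subseteq> {..<?N}" "card S = t" "\<forall>u\<in>S. \<forall>v\<in>S. (u, v) \<notin> ?E"
      unfolding has_independent_set_def H by blast
    have "(u, v) \<notin> E" if "u \<in> f ` S" "v \<in> f ` S" for u v
      using S(1,3) that by blast
    then show thesis
      using that(2)[of "f ` S"] sub S by blast
  qed
qed

text \<open>A complete graph has no independent set of size \<open>t \<ge> 2\<close>, so one on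
  \<open>ramsey_number r t\<close> vertices must contain a clique of size \<open>r\<close>. This
  yields the strict inequality at the end of the main proof.\<close>

lemma ramsey_number_ge:
  assumes "t \<ge> 2"
  shows "ramsey_number r t \<ge> r"
proof (rule ccontr)
  let ?N = "ramsey_number r t"
  assume less: "\<not> ?thesis"
  have "sym {(i, j). i \<noteq> (j::nat)}" "irrefl {(i, j). i \<noteq> (j::nat)}"
    by (auto simp: sym_def irrefl_def)
  then show False
  proof (rule ramsey_number_relation[of "{..<?N}" r t "{(i, j). i \<noteq> (j::nat)}", rotated 2])
    fix S assume "S \<subseteq> {..<?N}" "card S = r"
    then show False
      using card_mono[of "{..<?N}" S] less by simp
  next
    fix S :: "nat set"
    assume S: "card S = t" "\<And>u v. u \<in> S \<Longrightarrow> v \<in> S \<Longrightarrow> (u, v) \<notin> {(i, j). i \<noteq> j}"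
    \<comment> \<open>Any two elements of \<open>S\<close> coincide. Finiteness of \<open>S\<close>
      follows from \<open>card S = t \<ge> 2\<close>, since infinite sets have cardinality
      0.\<close>
    then have "card S \<le> 1"
      by (intro card_le_Suc0_iff_eq[THEN iffD2, unfolded One_nat_def[symmetric]])
         (use assms card.infinite in \<open>fastforce+\<close>)
    then show False
      using S(1) assms by simp
  qed auto
qed

text \<open>
  The Motzkin-Straus inequality, stated for the complementary quadratic form. The induction
  removes the non-neighbours of a vertex \<open>v\<close> for which their weight \<open>f v\<close> is minimal.
\<close>

lemma motzkin_straus:
  fixes y :: "'a \<Rightarrow> real"
  assumes "finite W" "sym E" "irrefl E" "\<And>u. u \<in> W \<Longrightarrow> y u \<ge> 0"
    and "\<And>S. S \<subseteq> W \<Longrightarrow> card S = Suc k \<Longrightarrow> \<not> pairwise (\<lambda>u v. (u, v) \<in> E) S"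
  shows "(\<Sum>u\<in>W. y u)\<^sup>2 \<le> real k * (\<Sum>u\<in>W. \<Sum>v\<in>{v\<in>W. (u, v) \<notin> E}. y u * y v)"
  using assms
proof (induction k arbitrary: W)
  case 0
  have "W = {}"
  proof (rule ccontr)
    assume "W \<noteq> {}"
    then obtain u where "u \<in> W" by blast
    then show False
      using "0.prems"(5)[of "{u}"] by (simp add: pairwise_def)
  qed
  then show ?case by simp
next
  case (Suc k)
  show ?case
  proof (cases "W = {}")
    case False
    define f where "f u = (\<Sum>v\<in>{v\<in>W. (u, v) \<notin> E}. y v)" for u
    obtain v where v: "v \<in> W" and f_min: "\<And>u. u \<in> W \<Longrightarrow> f v \<le> f u"
      using ex_is_arg_min_if_finite[OF Suc.prems(1) False, of f] by (auto simp: is_arg_min_linorder)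
    define A where "A = {u\<in>W. (v, u) \<in> E}"
    define B where "B = {u\<in>W. (v, u) \<notin> E}"
    have split: "W = A \<union> B" "A \<inter> B = {}" "finite A" "finite B" "A \<subseteq> W"
      using Suc.prems(1) by (auto simp: A_def B_def)
    define T where "T = (\<Sum>u\<in>A. y u)"
    define Q where "Q = (\<Sum>u\<in>A. \<Sum>w\<in>{w\<in>A. (u, w) \<notin> E}. y u * y w)"
    have fv: "f v = (\<Sum>u\<in>B. y u)"
      by (simp add: f_def B_def)
    have fv0: "f v \<ge> 0"
      unfolding fv using Suc.prems(4) by (intro sum_nonneg) (auto simp: B_def)
    have "T\<^sup>2 \<le> real k * Q"
      unfolding T_def Q_def
    proof (rule Suc.IH)
      fix S assume S: "S \<subseteq> A" "card S = Suc k"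
      show "\<not> pairwise (\<lambda>u v. (u, v) \<in> E) S"
      proof
        assume "pairwise (\<lambda>u v. (u, v) \<in> E) S"
        then have "pairwise (\<lambda>u v. (u, v) \<in> E) (insert v S)"
          using S(1) Suc.prems(2) by (auto simp: pairwise_insert A_def dest: symD)
        moreover have "v \<notin> S"
          using S(1) Suc.prems(3) by (auto simp: A_def irrefl_def)
        then have "card (insert v S) = Suc (Suc k)"
          using S split(3) finite_subset by (metis card_insert_disjoint)
        ultimately show False
          using Suc.prems(5)[of "insert v S"] S(1) split(5) v by blast
      qed
    qed (use Suc.prems split in auto)
    moreover have Q0: "Q \<ge> 0"
      unfolding Q_def using Suc.prems(4) split(5) by (intro sum_nonneg mult_nonneg_nonneg) auto
    \<comment> \<open>A weighted Cauchy-Schwarz estimate combined with the induction hypothesis. For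
      \<open>k = 0\<close> that hypothesis forces \<open>T = 0\<close>; the other case cancels a
      factor \<open>k\<close>.\<close>
    moreover have "(f v + T)\<^sup>2 \<le> real (Suc k) * ((f v)\<^sup>2 + Q)"
    proof (cases "k = 0")
      case True
      then show ?thesis
        using \<open>T\<^sup>2 \<le> real k * Q\<close> Q0 by simp
    next
      case False
      \<comment> \<open>The added square completes the identity
        \<open>k (a + T)^2 + (k a - T)^2 = (k + 1) (k a^2 + T^2)\<close> with
        \<open>a = f v\<close>.\<close>
      have "real k * (f v + T)\<^sup>2 \<le> real k * (f v + T)\<^sup>2 + (real k * f v - T)\<^sup>2"
        by simp
      also have "\<dots> = (real k + 1) * (real k * (f v)\<^sup>2 + T\<^sup>2)"
        by (simp add: power2_eq_square algebra_simps)
      also have "\<dots> \<le> (real k + 1) * (real k * (f v)\<^sup>2 + real k * Q)"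
        using \<open>T\<^sup>2 \<le> real k * Q\<close> by (intro mult_left_mono) auto
      also have "\<dots> = real k * (real (Suc k) * ((f v)\<^sup>2 + Q))"
        by (simp add: algebra_simps)
      finally show ?thesis
        using False by simp
    qed
    \<comment> \<open>On \<open>B\<close>, whose total weight is \<open>f v\<close>, minimality of
      \<open>f v\<close> applies. On \<open>A\<close>, \<open>f u\<close> also counts non-neighbours
      of \<open>u\<close> outside \<open>A\<close>, which only adds nonnegative terms.\<close>
    moreover have "(f v)\<^sup>2 + Q \<le> (\<Sum>u\<in>W. y u * f u)"
    proof -
      have "(f v)\<^sup>2 = (\<Sum>u\<in>B. y u * f v)"
        by (simp add: fv power2_eq_square sum_distrib_right)
      also have "\<dots> \<le> (\<Sum>u\<in>B. y u * f u)"
        using f_min Suc.prems(4) by (intro sum_mono mult_left_mono) (auto simp: B_def)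
      finally have 1: "(f v)\<^sup>2 \<le> (\<Sum>u\<in>B. y u * f u)" .
      have "(\<Sum>w\<in>{w\<in>A. (u, w) \<notin> E}. y u * y w) \<le> y u * f u" if "u \<in> A" for u
      proof -
        have "(\<Sum>w\<in>{w\<in>A. (u, w) \<notin> E}. y w) \<le> f u"
          unfolding f_def using Suc.prems(1,4) by (intro sum_mono2) (auto simp: A_def)
        then have "y u * (\<Sum>w\<in>{w\<in>A. (u, w) \<notin> E}. y w) \<le> y u * f u"
          using that Suc.prems(4) split(5) by (intro mult_left_mono) auto
        then show ?thesis
          by (simp add: sum_distrib_left)
      qed
      then have "Q \<le> (\<Sum>u\<in>A. y u * f u)"
        unfolding Q_def by (rule sum_mono)
      with 1 show ?thesis
        unfolding split(1) using split by (subst sum.union_disjoint) auto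
    qed
    then have "real (Suc k) * ((f v)\<^sup>2 + Q) \<le> real (Suc k) * (\<Sum>u\<in>W. y u * f u)"
      by (intro mult_left_mono) auto
    moreover have "(\<Sum>u\<in>W. y u) = f v + T"
      unfolding fv T_def using split by (subst split(1), subst sum.union_disjoint) auto
    ultimately show ?thesis
      by (simp add: f_def sum_distrib_left)
  qed simp
qed

section \<open>The largest eigenvalue and an eigenvector indexed by vertices\<close>

text \<open>A complex eigenvalue exists, the Hermitian form shows that it is real, and it is then a
  root of the real characteristic polynomial. Nonemptiness makes the \<open>Max\<close> in
  \<open>largest_eigenvalue\<close> meaningful.\<close>

lemma spectrum_real_symmetric_nonempty:
  fixes A :: "real mat"
  assumes A: "A \<in> carrier_mat n n" and symm: "transpose_mat A = A" and "n > 0"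
  shows "spectrum A \<noteq> {}"
proof -
  define B :: "complex mat" where "B = map_mat of_real A"
  have B: "B \<in> carrier_mat n n"
    using A by (simp add: B_def)
  obtain \<mu> where \<mu>: "eigenvalue B \<mu>"
    using spectrum_non_empty[OF B \<open>n > 0\<close>] by (auto simp: spectrum_def)
  then obtain v where v: "v \<in> carrier_vec n" "v \<noteq> 0\<^sub>v n" "B *\<^sub>v v = \<mu> \<cdot>\<^sub>v v"
    using B by (auto simp: eigenvalue_def eigenvector_def)
  have row: "(\<Sum>j<n. of_real (A $$ (i, j)) * v $ j) = \<mu> * v $ i" if "i < n" for i
  proof -
    have "(B *\<^sub>v v) $ i = (\<Sum>j<n. of_real (A $$ (i, j)) * v $ j)"
      using that A v(1) by (auto simp: B_def scalar_prod_def lessThan_atLeast0 intro!: sum.cong)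
    then show ?thesis
      using v that by simp
  qed
  define q where "q = (\<Sum>i<n. (cmod (v $ i))\<^sup>2)"
  \<comment> \<open>The Hermitian form of \<open>A\<close> at \<open>v\<close>. It equals
    \<open>\<mu>\<close> times the squared norm \<open>q\<close>, and symmetry of \<open>A\<close>
    makes it invariant under conjugation.\<close>
  define s where "s = (\<Sum>i<n. \<Sum>j<n. of_real (A $$ (i, j)) * v $ j * cnj (v $ i))"
  have "s = (\<Sum>i<n. \<mu> * v $ i * cnj (v $ i))"
    unfolding s_def by (intro sum.cong refl) (simp add: row[symmetric] sum_distrib_right)
  also have "\<dots> = \<mu> * of_real q"
    by (simp add: q_def sum_distrib_left mult.assoc complex_norm_square[symmetric])
  finally have s: "s = \<mu> * of_real q" .
  have sA: "A $$ (i, j) = A $$ (j, i)" if "i < n" "j < n" for i j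
    using that A symm by (metis carrier_matD index_transpose_mat(1))
  have "cnj s = (\<Sum>i<n. \<Sum>j<n. of_real (A $$ (i, j)) * cnj (v $ j) * v $ i)"
    by (simp add: s_def)
  also have "\<dots> = (\<Sum>j<n. \<Sum>i<n. of_real (A $$ (i, j)) * cnj (v $ j) * v $ i)"
    by (rule sum.swap)
  also have "\<dots> = s"
    unfolding s_def by (intro sum.cong refl) (use sA in \<open>auto simp: mult.commute mult.left_commute\<close>)
  finally have "cnj \<mu> * of_real q = \<mu> * of_real q"
    unfolding s by simp
  moreover have "q \<noteq> 0"
  proof
    assume "q = 0"
    then have "v $ i = 0" if "i < n" for i
      using that by (auto simp: q_def sum_nonneg_eq_0_iff)
    then show False
      using v(1,2) by (auto intro: eq_vecI)
  qed
  ultimately have "cnj \<mu> = \<mu>"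
    by simp
  then obtain m where m: "\<mu> = of_real m"
    by (metis Reals_cases Reals_cnj_iff)
  have "poly (char_poly B) \<mu> = 0"
    using \<mu> eigenvalue_root_char_poly[OF B] by blast
  then have "poly (char_poly A) m = 0"
    unfolding B_def m of_real_hom.char_poly_hom[OF A] by simp
  then show ?thesis
    using eigenvalue_root_char_poly[OF A] by (auto simp: spectrum_def)
qed

text \<open>The maximum of the finite nonempty spectrum is attained; the entries of an eigenvector
  are carried from matrix indices to vertices along the enumeration \<open>g\<close>.\<close>

lemma (in graph) largest_eigenvalue_eigenvector:
  assumes "verts G \<noteq> {}"
  obtains x :: "'a \<Rightarrow> real" where
    "\<And>w. w \<in> verts G \<Longrightarrow> (\<Sum>u\<in>{u\<in>verts G. (w, u) \<in> arcs_ends G}. x u) = largest_eigenvalue G * x w"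
    "\<exists>w\<in>verts G. x w \<noteq> 0"
proof -
  define n where "n = card (verts G)"
  define A where "A = adjacency_matrix G"
  define g where "g = from_nat_into (verts G)"
  let ?lam = "largest_eigenvalue G"
  have g: "bij_betw g {..<n} (verts G)"
    unfolding g_def n_def by (rule bij_betw_from_nat_into_finite) simp
  have A: "A \<in> carrier_mat n n"
    by (simp add: A_def adjacency_matrix_def n_def)
  have entry: "A $$ (i, j) = (if (g i, g j) \<in> arcs_ends G then 1 else 0)" if "i < n" "j < n" for i j
    using that by (simp add: A_def adjacency_matrix_def n_def g_def)
  have "transpose_mat A = A"
    using A entry arcs_ends_symmetric[OF sym_arcs] by (intro eq_matI) auto
  moreover have "n > 0"
    using assms by (simp add: n_def card_gt_0_iff)
  ultimately have "spectrum A \<noteq> {}"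
    using spectrum_real_symmetric_nonempty[OF A] by blast
  then have "?lam \<in> spectrum A"
    unfolding largest_eigenvalue_def A_def[symmetric]
    by (intro Max_in card_finite_spectrum(1)[OF A])
  then obtain v where v: "v \<in> carrier_vec n" "v \<noteq> 0\<^sub>v n" "A *\<^sub>v v = ?lam \<cdot>\<^sub>v v"
    using A by (auto simp: spectrum_def eigenvalue_def eigenvector_def)
  define x where "x u = v $ (inv_into {..<n} g u)" for u
  have xg: "x (g i) = v $ i" if "i < n" for i
    using g that by (simp add: x_def bij_betw_inv_into_left)
  show thesis
  proof
    fix w assume "w \<in> verts G"
    then obtain i where i: "i < n" "w = g i"
      using g by (auto simp: bij_betw_def)
    have "(\<Sum>u\<in>{u\<in>verts G. (w, u) \<in> arcs_ends G}. x u)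
        = (\<Sum>u\<in>verts G. if (w, u) \<in> arcs_ends G then x u else 0)"
      by (simp add: sum.inter_filter)
    also have "\<dots> = (\<Sum>j<n. if (w, g j) \<in> arcs_ends G then x (g j) else 0)"
      by (rule sum.reindex_bij_betw[OF g, symmetric])
    also have "\<dots> = (\<Sum>j<n. A $$ (i, j) * v $ j)"
      by (intro sum.cong refl) (simp add: entry i xg)
    also have "\<dots> = (A *\<^sub>v v) $ i"
      using i A v(1) by (auto simp: scalar_prod_def lessThan_atLeast0 intro!: sum.cong)
    also have "\<dots> = ?lam * x w"
      using i v xg by simp
    finally show "(\<Sum>u\<in>{u\<in>verts G. (w, u) \<in> arcs_ends G}. x u) = ?lam * x w" .
  next
    obtain i where "i < n" "v $ i \<noteq> 0"
      using v(1,2) by (metis carrier_vecD eq_vecI index_zero_vec)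
    then show "\<exists>w\<in>verts G. x w \<noteq> 0"
      using g xg by (metis bij_betw_apply lessThan_iff)
  qed
qed

section \<open>Codegrees of nonadjacent vertices and the eigenvalue estimate\<close>

text \<open>Otherwise Ramsey applies to the common neighbourhood: an \<open>r\<close>-clique there
  extends by \<open>u\<close> to a forbidden clique, and an independent \<open>t\<close>-set forms
  an induced bipartite graph with \<open>{u, v}\<close>.\<close>

lemma (in graph) common_neighbours_bound:
  assumes "clique_free G (r + 1)" "\<not> has_induced_complete_bipartite G 2 t"
    and "u \<in> verts G" "v \<in> verts G" "u \<noteq> v" "(u, v) \<notin> arcs_ends G"
  shows "card {w\<in>verts G. (w, u) \<in> arcs_ends G \<and> (w, v) \<in> arcs_ends G} < ramsey_number r t"
    (is "card ?W < _")
proof (rule ccontr)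
  note adj_sym = arcs_ends_symmetric[OF sym_arcs]
  assume "\<not> ?thesis"
  then have "card ?W \<ge> ramsey_number r t"
    by simp
  have "sym (arcs_ends G)" "irrefl (arcs_ends G)"
    using adj_sym adj_not_same by (auto simp: sym_def irrefl_def)
  then show False
  proof (rule ramsey_number_relation[of ?W r t "arcs_ends G", rotated 2])
    fix S assume S: "S \<subseteq> ?W" "card S = r" "pairwise (\<lambda>u v. (u, v) \<in> arcs_ends G) S"
    have "u \<notin> S"
      using S(1) adj_not_same by blast
    moreover have "finite S"
      using S(1) finite_verts by (auto intro: finite_subset)
    moreover have "pairwise (\<lambda>u v. (u, v) \<in> arcs_ends G) (insert u S)"
      using S adj_sym by (auto simp: pairwise_insert)
    moreover have "insert u S \<subseteq> verts G"
      using S(1) assms(3) by blast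
    ultimately have "has_clique G (r + 1)"
      unfolding has_clique_iff using S(2) by (intro exI[of _ "insert u S"]) auto
    then show False
      using assms(1) by (simp add: clique_free_def)
  next
    fix S
    assume S: "S \<subseteq> ?W" "card S = t" "\<And>a b. a \<in> S \<Longrightarrow> b \<in> S \<Longrightarrow> (a, b) \<notin> arcs_ends G"
    have "has_induced_complete_bipartite G 2 t"
    proof (rule has_induced_complete_bipartiteI[of "{u, v}" S])
      show "(a, b) \<in> arcs_ends G" if "a \<in> {u, v}" "b \<in> S" for a b
        using that S(1) adj_sym by blast
    qed (use S assms adj_sym adj_not_same in auto)
    then show False
      using assms(2) by simp
  qed (use \<open>card ?W \<ge> ramsey_number r t\<close> in auto)
qed

theorem theorem2:
  fixes G :: "('a, 'b) pre_digraph" and r t n :: nat and K :: real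
  assumes "r \<ge> 2" and "t \<ge> 2"
    and "K \<ge> real (ramsey_number r t)"
    and "graph G" and "card (verts G) = n" and "n \<ge> 1"
    and "clique_free G (r + 1)"
    and "largest_eigenvalue G \<ge> K * sqrt (real n)"
  shows "has_induced_complete_bipartite G 2 t"
proof (rule ccontr)
  assume no_bip: "\<not> ?thesis"
  interpret graph G by fact
  define V where "V = verts G"
  define E where "E = arcs_ends G"
  define R where "R = ramsey_number r t"
  define lam where "lam = largest_eigenvalue G"
  have finV: "finite V" and cardV: "card V = n"
    using assms by (auto simp: V_def)
  have symE: "sym E" and irreflE: "irrefl E"
    using arcs_ends_symmetric[OF sym_arcs] adj_not_same by (auto simp: sym_def irrefl_def E_def)
  have "V \<noteq> {}"
    using assms cardV by auto
  then obtain x :: "'a \<Rightarrow> real" where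
    x: "\<And>w. w \<in> V \<Longrightarrow> (\<Sum>u\<in>{u\<in>V. (w, u) \<in> E}. x u) = lam * x w" and
    x_nz: "\<exists>w\<in>V. x w \<noteq> 0"
    unfolding V_def E_def lam_def by (rule largest_eigenvalue_eigenvector) blast
  \<comment> \<open>Motzkin-Straus needs nonnegative weights. Since \<open>lam \<ge> 0\<close>, the
    triangle inequality turns the eigenvalue equation for \<open>x\<close> into an upper bound on
    \<open>lam * y w\<close>.\<close>
  define y where "y u = \<bar>x u\<bar>" for u
  define Y where "Y = (\<Sum>u\<in>V. (y u)\<^sup>2)"
  have "R \<ge> r"
    unfolding R_def using assms(2) by (rule ramsey_number_ge)
  have "R * sqrt n \<le> K * sqrt n"
    using assms(3) by (intro mult_right_mono) (auto simp: R_def)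
  then have lam: "lam \<ge> R * sqrt n"
    using assms(8) by (simp add: lam_def)
  then have lam0: "lam \<ge> 0"
    by (smt (verit) mult_nonneg_nonneg of_nat_0_le_iff real_sqrt_ge_zero)
  have "Y > 0"
    unfolding Y_def using x_nz finV by (auto simp: y_def intro: sum_pos2)

  define c where "c u v = card {w\<in>V. (w, u) \<in> E \<and> (w, v) \<in> E}" for u v
  \<comment> \<open>Adjacent pairs contribute 0 and distinct nonadjacent ones at most
    \<open>R - 1\<close>. Allowing \<open>R - 1\<close> on the diagonal as well lets the constant
    part sum to a multiple of the square of the total weight.\<close>
  have codeg: "real (if (u, v) \<in> E then 0 else c u v) \<le> real (R - 1) + (if u = v then real n else 0)"
    if "u \<in> V" "v \<in> V" for u v
  proof (cases "u = v")
    case True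
    have "c u v \<le> n"
      unfolding c_def cardV[symmetric] using finV by (intro card_mono) auto
    with True show ?thesis by simp
  next
    case False
    with that show ?thesis
      using common_neighbours_bound[OF assms(7) no_bip, of u v]
      by (auto simp: c_def V_def E_def R_def)
  qed

  have local: "lam\<^sup>2 * (y w)\<^sup>2 \<le> real (r - 1) *
      (\<Sum>u\<in>V. \<Sum>v\<in>V. if (w, u) \<in> E \<and> (w, v) \<in> E \<and> (u, v) \<notin> E then y u * y v else 0)"
    if w: "w \<in> V" for w
  proof -
    let ?N = "{u\<in>V. (w, u) \<in> E}"
    have "lam * y w = \<bar>\<Sum>u\<in>?N. x u\<bar>"
      using lam0 x[OF w] by (simp add: y_def abs_mult)
    also have "\<dots> \<le> (\<Sum>u\<in>?N. y u)"
      unfolding y_def by (rule sum_abs)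
    finally have "(lam * y w)\<^sup>2 \<le> (\<Sum>u\<in>?N. y u)\<^sup>2"
      using lam0 by (intro power_mono) (auto simp: y_def)
    \<comment> \<open>Motzkin-Straus with \<open>k = r - 1\<close>: an \<open>r\<close>-clique among
      the neighbours of \<open>w\<close> would extend by \<open>w\<close> to size
      \<open>r + 1\<close>.\<close>
    also have "\<dots> \<le> real (r - 1) * (\<Sum>u\<in>?N. \<Sum>v\<in>{v\<in>?N. (u, v) \<notin> E}. y u * y v)"
    proof (rule motzkin_straus[OF _ symE irreflE])
      fix S assume S: "S \<subseteq> ?N" "card S = Suc (r - 1)"
      show "\<not> pairwise (\<lambda>u v. (u, v) \<in> E) S"
      proof
        assume "pairwise (\<lambda>u v. (u, v) \<in> E) S"
        then have "pairwise (\<lambda>u v. (u, v) \<in> E) (insert w S)"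
          using S(1) symE by (auto simp: pairwise_insert dest: symD)
        moreover have "w \<notin> S" "finite S"
          using S(1) irreflE finV by (auto simp: irrefl_def intro: finite_subset)
        then have "card (insert w S) = r + 1"
          using S assms(1) by simp
        moreover have "insert w S \<subseteq> V"
          using S(1) w by blast
        ultimately have "has_clique G (r + 1)"
          unfolding has_clique_iff V_def E_def by blast
        then show False
          using assms(7) by (simp add: clique_free_def)
      qed
    qed (use finV in \<open>auto simp: y_def\<close>)
    also have "(\<Sum>u\<in>?N. \<Sum>v\<in>{v\<in>?N. (u, v) \<notin> E}. y u * y v) =
        (\<Sum>u\<in>V. \<Sum>v\<in>V. if (w, u) \<in> E \<and> (w, v) \<in> E \<and> (u, v) \<notin> E then y u * y v else 0)"
      using finV by (auto simp: sum.inter_filter intro!: sum.cong)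
    finally show ?thesis
      by (simp add: power_mult_distrib)
  qed

  have "lam\<^sup>2 * Y \<le> real (r - 1) * (\<Sum>w\<in>V. \<Sum>u\<in>V. \<Sum>v\<in>V.
      if (w, u) \<in> E \<and> (w, v) \<in> E \<and> (u, v) \<notin> E then y u * y v else 0)"
    unfolding Y_def sum_distrib_left[of _ _ V] using local by (intro sum_mono) (simp add: sum_distrib_left)
  also have "(\<Sum>w\<in>V. \<Sum>u\<in>V. \<Sum>v\<in>V.
      if (w, u) \<in> E \<and> (w, v) \<in> E \<and> (u, v) \<notin> E then y u * y v else 0) =
      (\<Sum>u\<in>V. \<Sum>v\<in>V. \<Sum>w\<in>V.
      if (w, u) \<in> E \<and> (w, v) \<in> E \<and> (u, v) \<notin> E then y u * y v else 0)"
    \<comment> \<open>Two exchanges move the sum over \<open>w\<close> innermost, where it counts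
      common neighbours.\<close>
    by (subst sum.swap) (intro sum.cong refl sum.swap)
  also have "\<dots> = (\<Sum>u\<in>V. \<Sum>v\<in>V. real (if (u, v) \<in> E then 0 else c u v) * (y u * y v))"
    using finV by (intro sum.cong refl) (auto simp: c_def sum.inter_filter[symmetric])
  also have "\<dots> \<le> (\<Sum>u\<in>V. \<Sum>v\<in>V. (real (R - 1) + (if u = v then real n else 0)) * (y u * y v))"
    by (intro sum_mono mult_right_mono codeg) (auto simp: y_def)
  also have "\<dots> = (\<Sum>u\<in>V. \<Sum>v\<in>V. real (R - 1) * (y u * y v) + (if u = v then real n * (y u * y v) else 0))"
    by (intro sum.cong refl) (simp add: algebra_simps)
  also have "\<dots> = real (R - 1) * (\<Sum>u\<in>V. y u)\<^sup>2 + real n * Y"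
    using finV
    by (simp add: sum.distrib Y_def power2_eq_square sum_product sum_distrib_left[symmetric])
  \<comment> \<open>Cauchy-Schwarz: the square of the sum of \<open>y\<close> over \<open>V\<close>
    is at most \<open>n * Y\<close>.\<close>
  also have "\<dots> \<le> real (R - 1) * (real n * Y) + real n * Y"
    using sum_squared_le_sum_of_squares[of y V] finV
    by (intro add_right_mono mult_left_mono) (auto simp: Y_def cardV mult.commute)
  also have "\<dots> = real R * (real n * Y)"
    using \<open>R \<ge> r\<close> assms(1) by (simp add: of_nat_diff algebra_simps)
  finally have "lam\<^sup>2 * Y \<le> real (r - 1) * (real R * (real n * Y))"
    by (simp add: mult_left_mono)
  \<comment> \<open>Strict because \<open>r - 1 < R\<close> and \<open>R * (n * Y)\<close> is
    positive.\<close>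
  also have "\<dots> < real R * (real R * (real n * Y))"
    using \<open>R \<ge> r\<close> assms(1,6) \<open>Y > 0\<close> by (intro mult_strict_right_mono) auto
  also have "\<dots> = (R * sqrt n)\<^sup>2 * Y"
    by (simp add: power_mult_distrib power2_eq_square)
  also have "\<dots> \<le> lam\<^sup>2 * Y"
    using lam \<open>Y > 0\<close> by (intro mult_right_mono power_mono) auto
  finally show False
    by simp
qed

end
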